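(* Let $a, b$ be two positive real numbers and $\nu \in (0,1)$. Then $$(a\nabla_{\nu} b)^2 \geq (a\sharp_{\nu} b)^2 + r_0^2(a-b)^2 + \sum_{k=1}^{\infty} r_k\Big[a^{1-\frac{m_k}{2^k}} b^{\frac{m_k}{2^k}} - a^{1-\frac{m_k+1}{2^k}} b^{\frac{m_k+1}{2^k}}\Big]^2 .$$
   Context: For positive reals $a,b$ and $\nu\in[0,1]$: $a\nabla_\nu b = (1-\nu)a+\nu b$ and $a\sharp_\nu b = a^{1-\nu}b^{\nu}$. For $0<\nu<1$ and integers $k\ge 0$, $m_k=\lfloor 2^k\nu\rfloor$ is the largest integer not greater than $2^k\nu$; $r_0=\min\{\nu,1-\nu\}$ and $r_k=\min\{2r_{k-1},\,1-2r_{k-1}\}$ for $k\ge 1$. The infinite series has nonnegative terms and is convergent. *)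

theory Defs
  imports Complex_Main
begin

definition wam :: "real \<Rightarrow> real \<Rightarrow> real \<Rightarrow> real"
  where "wam \<nu> a b = (1 - \<nu>) * a + \<nu> * b"

definition wgm :: "real \<Rightarrow> real \<Rightarrow> real \<Rightarrow> real"
  where "wgm \<nu> a b = a powr (1 - \<nu>) * b powr \<nu>"

definition dyadic_idx :: "real \<Rightarrow> nat \<Rightarrow> int"
  where "dyadic_idx \<nu> k = \<lfloor>2 ^ k * \<nu>\<rfloor>"

primrec ref_coeff :: "real \<Rightarrow> nat \<Rightarrow> real"
  where
    "ref_coeff \<nu> 0 = min \<nu> (1 - \<nu>)"
  | "ref_coeff \<nu> (Suc k) = min (2 * ref_coeff \<nu> k) (1 - 2 * ref_coeff \<nu> k)"

definition refinement_term :: "real \<Rightarrow> real \<Rightarrow> real \<Rightarrow> nat \<Rightarrow> real"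
  where "refinement_term \<nu> a b k =
    ref_coeff \<nu> k *
      (a powr (1 - of_int (dyadic_idx \<nu> k) / 2 ^ k) * b powr (of_int (dyadic_idx \<nu> k) / 2 ^ k)
       - a powr (1 - (of_int (dyadic_idx \<nu> k) + 1) / 2 ^ k) * b powr ((of_int (dyadic_idx \<nu> k) + 1) / 2 ^ k))\<^sup>2"

end

theory Submission
  imports Defs
begin

text \<open>
  Put \<open>g t = a\<^bsup>1-t\<^esup> b\<^bsup>t\<^esup>\<close> and let \<open>L\<^sub>k\<close> be the value at \<open>\<nu>\<close> of the chord of the convex function \<open>g\<^sup>2\<close>
  over the dyadic interval of length \<open>2\<^sup>-\<^sup>k\<close> containing \<open>\<nu>\<close>. As \<open>g\<^sup>2\<close> at the midpoint of an interval is
  the product of the values of \<open>g\<close> at its endpoints, halving the interval lowers the chord by exactly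
  the \<open>k\<close>-th term of the series. So the \<open>n\<close>-th partial sum, including \<open>k = 0\<close>, is \<open>L\<^sub>0 - L\<^sub>n\<close>, which is at most
  \<open>L\<^sub>0 - g(\<nu>)\<^sup>2\<close> by convexity. Finally \<open>L\<^sub>0 = (1 - \<nu>) a\<^sup>2 + \<nu> b\<^sup>2\<close> exceeds the square of the arithmetic
  mean by \<open>\<nu> (1 - \<nu>) (a - b)\<^sup>2 = (r\<^sub>0 - r\<^sub>0\<^sup>2) (a - b)\<^sup>2\<close>.
\<close>

text \<open>Relative position of \<nu> in its dyadic interval of level \<open>k\<close>, hence the
  weight of the right endpoint in the chord.\<close>

definition dyadic_frac :: "real \<Rightarrow> nat \<Rightarrow> real"
  where "dyadic_frac \<nu> k = 2 ^ k * \<nu> - of_int (dyadic_idx \<nu> k)"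

definition dyadic_chord :: "real \<Rightarrow> real \<Rightarrow> real \<Rightarrow> nat \<Rightarrow> real"
  where "dyadic_chord \<nu> a b k =
    (1 - dyadic_frac \<nu> k) * (wgm (of_int (dyadic_idx \<nu> k) / 2 ^ k) a b)\<^sup>2
      + dyadic_frac \<nu> k * (wgm ((of_int (dyadic_idx \<nu> k) + 1) / 2 ^ k) a b)\<^sup>2"

lemma dyadic_frac_ge_0: "0 \<le> dyadic_frac \<nu> k"
  and dyadic_frac_less_1: "dyadic_frac \<nu> k < 1"
  unfolding dyadic_frac_def dyadic_idx_def by linarith+

lemma dyadic_idx_Suc:
  "dyadic_idx \<nu> (Suc k) = 2 * dyadic_idx \<nu> k + (if dyadic_frac \<nu> k < 1/2 then 0 else 1)"
  using dyadic_frac_ge_0[of \<nu> k] dyadic_frac_less_1[of \<nu> k]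
  unfolding dyadic_idx_def[of \<nu> "Suc k"] dyadic_frac_def
  by (intro floor_unique) (auto split: if_splits)

lemma dyadic_frac_Suc:
  "dyadic_frac \<nu> (Suc k) = 2 * dyadic_frac \<nu> k - (if dyadic_frac \<nu> k < 1/2 then 0 else 1)"
  by (simp add: dyadic_frac_def[of \<nu> "Suc k"] dyadic_idx_Suc) (simp add: dyadic_frac_def)

lemma dyadic_idx_0: "0 < \<nu> \<Longrightarrow> \<nu> < 1 \<Longrightarrow> dyadic_idx \<nu> 0 = 0"
  by (simp add: dyadic_idx_def floor_eq_iff)

text \<open>The fractional part evolves by doubling modulo 1. Folding by the symmetry
  \<open>s\<close> to \<open>1 - s\<close> turns this into the recursion of
  \<open>ref_coeff\<close>, which is thus the distance from \<open>2 ^ k * \<nu>\<close> to the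
  nearest integer.\<close>

lemma ref_coeff_eq_min:
  assumes "0 < \<nu>" and "\<nu> < 1"
  shows "ref_coeff \<nu> k = min (dyadic_frac \<nu> k) (1 - dyadic_frac \<nu> k)"
proof (induction k)
  case 0
  then show ?case using assms by (simp add: dyadic_frac_def dyadic_idx_0)
next
  case (Suc k)
  then show ?case by (auto simp: dyadic_frac_Suc min_def)
qed

lemma wgm_eq_exp:
  assumes "a > 0" and "b > 0"
  shows "wgm t a b = exp ((1 - t) * ln a + t * ln b)"
  using assms by (simp add: wgm_def powr_def exp_add)

lemma wgm_midpoint_square:
  assumes "a > 0" and "b > 0"
  shows "(wgm ((s + t) / 2) a b)\<^sup>2 = wgm s a b * wgm t a b"
  using assms
  by (simp add: wgm_eq_exp power2_eq_square field_simps flip: exp_add)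

text \<open>The tangent at the averaged point \<open>z\<close> lies below the graph; averaging its
  values at \<open>x\<close> and \<open>y\<close> cancels the linear terms.\<close>

lemma exp_convex_combination:
  fixes s x y :: real
  assumes "0 \<le> s" and "s \<le> 1"
  shows "exp ((1 - s) * x + s * y) \<le> (1 - s) * exp x + s * exp y"
proof -
  define z where "z = (1 - s) * x + s * y"
  have tangent: "exp z * (1 + (u - z)) \<le> exp u" for u
    using mult_left_mono[OF exp_ge_add_one_self[of "u - z"], of "exp z"]
    by (simp flip: exp_add)
  have "exp z = (1 - s) * (exp z * (1 + (x - z))) + s * (exp z * (1 + (y - z)))"
    by (simp add: z_def algebra_simps)
  also have "\<dots> \<le> (1 - s) * exp x + s * exp y"
    using assms by (intro add_mono mult_left_mono tangent) auto
  finally show ?thesis by (simp add: z_def)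
qed

lemma wgm_square_le_dyadic_chord:
  assumes "a > 0" and "b > 0"
  shows "(wgm \<nu> a b)\<^sup>2 \<le> dyadic_chord \<nu> a b k"
proof -
  define s m where "s = dyadic_frac \<nu> k" and "m = real_of_int (dyadic_idx \<nu> k)"
  define p q where "p = m / 2 ^ k" and "q = (m + 1) / 2 ^ k"
  have \<nu>: "\<nu> = (1 - s) * p + s * q"
    by (simp add: p_def q_def s_def m_def dyadic_frac_def field_simps)
  \<comment> \<open>The exponent is affine in \<open>t\<close>, so convexity of \<open>exp\<close>
    is all that is needed.\<close>
  have sq: "(wgm t a b)\<^sup>2 = exp (2 * ((1 - t) * ln a + t * ln b))" for t
    by (simp only: wgm_eq_exp[OF assms] exp_double)
  have "(wgm \<nu> a b)\<^sup>2
      = exp ((1 - s) * (2 * ((1 - p) * ln a + p * ln b)) + s * (2 * ((1 - q) * ln a + q * ln b)))"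
    unfolding sq by (simp add: \<nu> algebra_simps)
  also have "\<dots> \<le> (1 - s) * (wgm p a b)\<^sup>2 + s * (wgm q a b)\<^sup>2"
    unfolding sq s_def using dyadic_frac_ge_0[of \<nu> k] dyadic_frac_less_1[of \<nu> k]
    by (intro exp_convex_combination) auto
  finally show ?thesis
    by (simp add: dyadic_chord_def p_def q_def s_def m_def)
qed

lemma dyadic_chord_diff:
  assumes "a > 0" and "b > 0" and "0 < \<nu>" and "\<nu> < 1"
  shows "dyadic_chord \<nu> a b k - dyadic_chord \<nu> a b (Suc k) = refinement_term \<nu> a b k"
proof -
  define s m where "s = dyadic_frac \<nu> k" and "m = real_of_int (dyadic_idx \<nu> k)"
  define P Q where "P = wgm (m / 2 ^ k) a b" and "Q = wgm ((m + 1) / 2 ^ k) a b"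
  have mid: "(wgm ((2 * m + 1) / (2 * 2 ^ k)) a b)\<^sup>2 = P * Q"
    using wgm_midpoint_square[OF assms(1,2), of "m / 2 ^ k" "(m + 1) / 2 ^ k"]
    by (simp add: P_def Q_def field_simps)
  have left: "2 * m / (2 * 2 ^ k) = m / 2 ^ k"
    and right: "(2 * m + 2) / (2 * 2 ^ k) = (m + 1) / 2 ^ k"
    by (simp_all add: field_simps)
  have term_eq: "refinement_term \<nu> a b k = min s (1 - s) * (P - Q)\<^sup>2"
    using assms by (simp add: refinement_term_def ref_coeff_eq_min s_def P_def Q_def m_def wgm_def)
  have chord: "dyadic_chord \<nu> a b k = (1 - s) * P\<^sup>2 + s * Q\<^sup>2"
    by (simp add: dyadic_chord_def s_def P_def Q_def m_def)
  show ?thesis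
  proof (cases "s < 1/2")
    \<comment> \<open>\<nu> lies in the left half: \<open>P\<close> stays, the midpoint replaces the
      right endpoint and the weight doubles. The chord drops by \<open>s * (P - Q)\<^sup>2\<close>;
      in the other case the factor is \<open>1 - s\<close>.\<close>
    case True
    then have "dyadic_chord \<nu> a b (Suc k) = (1 - 2 * s) * P\<^sup>2 + 2 * s * (P * Q)"
      unfolding dyadic_chord_def dyadic_frac_Suc dyadic_idx_Suc s_def[symmetric]
      using left mid by (simp add: P_def flip: m_def)
    with True show ?thesis
      by (simp add: term_eq chord min_def power2_eq_square algebra_simps)
  next
    case False
    then have "dyadic_chord \<nu> a b (Suc k) = (2 - 2 * s) * (P * Q) + (2 * s - 1) * Q\<^sup>2"
      unfolding dyadic_chord_def dyadic_frac_Suc dyadic_idx_Suc s_def[symmetric]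
      using right mid by (simp add: Q_def add.assoc flip: m_def)
    moreover have "min s (1 - s) = 1 - s"
      using False by simp
    ultimately show ?thesis
      by (simp add: term_eq chord power2_eq_square algebra_simps)
  qed
qed

lemma refinement_term_nonneg:
  assumes "0 < \<nu>" and "\<nu> < 1"
  shows "0 \<le> refinement_term \<nu> a b k"
  using assms dyadic_frac_ge_0[of \<nu> k] dyadic_frac_less_1[of \<nu> k]
  by (simp add: refinement_term_def ref_coeff_eq_min)

theorem theorem2p7:
  fixes a b \<nu> :: real
  assumes "a > 0" and "b > 0" and "0 < \<nu>" and "\<nu> < 1"
  shows "summable (\<lambda>k. refinement_term \<nu> a b (Suc k)) \<and>
    (wam \<nu> a b)\<^sup>2 \<ge> (wgm \<nu> a b)\<^sup>2 + (ref_coeff \<nu> 0)\<^sup>2 * (a - b)\<^sup>2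
      + (\<Sum>k. refinement_term \<nu> a b (Suc k))"
proof -
  define f where "f k = refinement_term \<nu> a b (Suc k)" for k
  \<comment> \<open>Telescoping starts at level 1, like the series; the term of level 0 is added
    separately, as its coefficient must still pass from \<open>ref_coeff \<nu> 0\<close> to its
    square.\<close>
  define B where "B = dyadic_chord \<nu> a b (Suc 0) - (wgm \<nu> a b)\<^sup>2"
  have f_nonneg: "0 \<le> f k" for k
    using assms by (simp add: f_def refinement_term_nonneg)
  have bound: "sum f {..<n} \<le> B" for n
  proof -
    have "sum f {..<n} = (\<Sum>k<n. dyadic_chord \<nu> a b (Suc k) - dyadic_chord \<nu> a b (Suc (Suc k)))"
      using assms by (simp add: f_def dyadic_chord_diff)
    also have "\<dots> = dyadic_chord \<nu> a b (Suc 0) - dyadic_chord \<nu> a b (Suc n)"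
      by (rule sum_lessThan_telescope')
    finally show ?thesis
      using wgm_square_le_dyadic_chord[OF assms(1,2), of \<nu> "Suc n"] by (simp add: B_def)
  qed
  have summable: "summable f"
    by (rule summableI_nonneg_bounded[OF f_nonneg bound])
  have "suminf f \<le> B"
    by (rule suminf_le_const[OF summable bound])
  moreover have "dyadic_chord \<nu> a b 0 = (1 - \<nu>) * a\<^sup>2 + \<nu> * b\<^sup>2"
    using assms by (simp add: dyadic_chord_def dyadic_frac_def dyadic_idx_0 wgm_def)
  moreover have "refinement_term \<nu> a b 0 = ref_coeff \<nu> 0 * (a - b)\<^sup>2"
    using assms by (simp add: refinement_term_def dyadic_idx_0)
  ultimately have "(wgm \<nu> a b)\<^sup>2 + ref_coeff \<nu> 0 * (a - b)\<^sup>2 + suminf f \<le> (1 - \<nu>) * a\<^sup>2 + \<nu> * b\<^sup>2"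
    using dyadic_chord_diff[OF assms, of 0] by (simp add: B_def)
  moreover have "(1 - \<nu>) * a\<^sup>2 + \<nu> * b\<^sup>2 = (wam \<nu> a b)\<^sup>2 + \<nu> * (1 - \<nu>) * (a - b)\<^sup>2"
    by (simp add: wam_def power2_eq_square algebra_simps)
  \<comment> \<open>\<open>t * (1 - t)\<close> takes the same value at \<nu> and
    \<open>1 - \<nu>\<close>, so either case of the minimum gives this.\<close>
  moreover have "ref_coeff \<nu> 0 * (a - b)\<^sup>2 = (ref_coeff \<nu> 0)\<^sup>2 * (a - b)\<^sup>2 + \<nu> * (1 - \<nu>) * (a - b)\<^sup>2"
    by (simp add: min_def power2_eq_square algebra_simps)
  ultimately show ?thesis
    using summable by (simp add: f_def[abs_def])
qed

end
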